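(* Let $x\in(0,1)$ be irrational and let $(p,q)$ be an even candidate pair for $x$. Then there is some proper continued fraction expansion of $x$ for which $p=p_2$ and $q=q_2$ if and only if there is some positive integer $a$ dividing $p$ such that $$T_p(x)+T_a(x)>1.$$
   Context: A proper continued fraction (PCF) expansion of an irrational $x\in(0,1)$ consists of sequences of positive integers $(a_n)_{n\ge1}$, $(b_n)_{n\ge1}$ with $b_n\ge a_n$ for all $n$ such that $$x=\cfrac{a_1}{b_1+\cfrac{a_2}{b_2+\ddots}},$$ meaning $x=\lim_{n\to\infty}p_n/q_n$, where $p_{-1}=1,\ p_0=0,\ q_{-1}=0,\ q_0=1$ and $p_n=b_np_{n-1}+a_np_{n-2}$, $q_n=b_nq_{n-1}+a_nq_{n-2}$ for $n\ge1$ (common factors of $p_n,q_n$ are not cancelled; in particular $p_2=a_1b_2$, $q_2=b_1b_2+a_2$). For a given sequence of numerators $(a_n)$ the expansion is unique and is produced by $x_0=x$, $b_n=\lfloor a_n/x_{n-1}\rfloor$, $x_n=a_n/x_{n-1}-b_n$. A pair of positive integers $(p,q)$ (not necessarily coprime) is a candidate for $x$ if $|x-p/q|<x/q$; it is an even candidate pair if moreover $p/q<x$. For a positive integer $N$, $T_N(x)=\frac{N}{x}-\left\lfloor\frac{N}{x}\right\rfloor$. *)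

theory Defs
  imports Complex_Main
begin

text \<open>
  The numerators \<open>a\<close> and denominators \<open>b\<close> of a continued fraction are indexed from 1;
  the values \<open>a 0\<close> and \<open>b 0\<close> are never used.  The initial values
  $p_{-1} = 1$, $q_{-1} = 0$ enter only through the equations for index 1.
\<close>

fun conv_num :: "(nat \<Rightarrow> nat) \<Rightarrow> (nat \<Rightarrow> nat) \<Rightarrow> nat \<Rightarrow> nat" where
  "conv_num a b 0 = 0"
| "conv_num a b (Suc 0) = b 1 * conv_num a b 0 + a 1 * 1"
| "conv_num a b (Suc (Suc n)) =
     b (Suc (Suc n)) * conv_num a b (Suc n) + a (Suc (Suc n)) * conv_num a b n"

fun conv_den :: "(nat \<Rightarrow> nat) \<Rightarrow> (nat \<Rightarrow> nat) \<Rightarrow> nat \<Rightarrow> nat" where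
  "conv_den a b 0 = 1"
| "conv_den a b (Suc 0) = b 1 * conv_den a b 0 + a 1 * 0"
| "conv_den a b (Suc (Suc n)) =
     b (Suc (Suc n)) * conv_den a b (Suc n) + a (Suc (Suc n)) * conv_den a b n"

definition pcf_expansion :: "real \<Rightarrow> (nat \<Rightarrow> nat) \<Rightarrow> (nat \<Rightarrow> nat) \<Rightarrow> bool" where
  "pcf_expansion x a b \<longleftrightarrow>
     (\<forall>n\<ge>1. 0 < a n \<and> 0 < b n \<and> a n \<le> b n) \<and>
     (\<lambda>n. real (conv_num a b n) / real (conv_den a b n)) \<longlonglongrightarrow> x"

definition candidate_pair :: "real \<Rightarrow> nat \<Rightarrow> nat \<Rightarrow> bool" where
  "candidate_pair x p q \<longleftrightarrow>
     0 < p \<and> 0 < q \<and> \<bar>x - real p / real q\<bar> < x / real q"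

definition even_candidate_pair :: "real \<Rightarrow> nat \<Rightarrow> nat \<Rightarrow> bool" where
  "even_candidate_pair x p q \<longleftrightarrow> candidate_pair x p q \<and> real p / real q < x"

definition T :: "nat \<Rightarrow> real \<Rightarrow> real" where
  "T N x = real N / x - of_int \<lfloor>real N / x\<rfloor>"

end

theory Submission
  imports Defs
begin

text \<open>
  The pair $(p,q)$ is an even candidate exactly when $q = \lfloor p/x \rfloor + 1$.
  If $p = p_2 = a_1 b_2$ and $q = q_2$, then $b_1 = \lfloor a_1/x \rfloor$, so
  $T_p(x) + T_{a_1}(x) > 1$ says precisely that $x < (p_2 + a_1)/(q_2 + b_1)$, the bound which
  every convergent from the second on satisfies because $b_3 \ge a_3$; irrationality
  of $x$ makes it strict in the limit.  Conversely, given
  $p = ad$, running the algorithm with numerators $a,\ q - \lfloor a/x \rfloor d,\ 1, 1, \dots$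
  produces the second denominator $d$.
\<close>

section \<open>The fractional parts of \<open>N / x\<close>\<close>

lemma T_bounds: "0 \<le> T N x" "T N x < 1"
  unfolding T_def by linarith+

lemma T_irrational:
  assumes "x \<notin> \<rat>" "0 < N"
  shows "T N x \<notin> \<rat>"
proof
  assume "T N x \<in> \<rat>"
  then have "T N x + of_int \<lfloor>real N / x\<rfloor> \<in> \<rat>" by simp
  then have "real N / x \<in> \<rat>" by (simp add: T_def)
  then have "real N / (real N / x) \<in> \<rat>" by (rule Rats_divide[OF Rats_of_nat])
  moreover have "real N / (real N / x) = x" using assms(2) by simp
  ultimately show False using assms(1) by simp
qed

lemma T_pos:
  assumes "x \<notin> \<rat>" "0 < N"
  shows "0 < T N x"
  using T_irrational[OF assms] T_bounds(1)[of N x] by (cases "T N x = 0") auto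

lemma T_eqI:
  assumes "real k \<le> real N / x" "real N / x < real k + 1"
  shows "T N x = real N / x - real k"
proof -
  have "\<lfloor>real N / x\<rfloor> = int k"
    using assms by (intro floor_unique) auto
  then show ?thesis by (simp add: T_def)
qed

section \<open>Existence of the expansion for prescribed numerators\<close>

fun pcf_rem :: "(nat \<Rightarrow> nat) \<Rightarrow> real \<Rightarrow> nat \<Rightarrow> real" where
  "pcf_rem a x 0 = x"
| "pcf_rem a x (Suc n) = T (a (Suc n)) (pcf_rem a x n)"

text \<open>For \<open>n = 0\<close> the truncated \<open>n - 1\<close> is again 0, which gives a
  harmless value at an index that no convergent reads.\<close>

definition pcf_denom :: "(nat \<Rightarrow> nat) \<Rightarrow> real \<Rightarrow> nat \<Rightarrow> nat" where
  "pcf_denom a x n = nat \<lfloor>real (a n) / pcf_rem a x (n - 1)\<rfloor>"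

text \<open>Irrationality passes from each remainder to the next, so no remainder vanishes and the
  algorithm never stops.\<close>

lemma pcf_rem_range:
  assumes "0 < x" "x < 1" "x \<notin> \<rat>" "\<forall>n\<ge>1. 0 < a n"
  shows "0 < pcf_rem a x n \<and> pcf_rem a x n < 1 \<and> pcf_rem a x n \<notin> \<rat>"
  using assms by (induction n) (auto simp: T_pos T_bounds T_irrational)

text \<open>With coefficients at least 1, each denominator is at least the sum of the previous two,
  hence grows at least linearly. This gives both positivity and the rate used for
  convergence.\<close>

lemma conv_den_ge:
  assumes "\<And>n. 1 \<le> n \<Longrightarrow> 0 < a n \<and> 0 < b n"
  shows "max 1 n \<le> conv_den a b n"
proof (induction n rule: less_induct)
  case (less n)
  consider "n = 0" | "n = 1" | m where "n = Suc (Suc m)"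
    by (metis One_nat_def not0_implies_Suc)
  then show ?case
  proof cases
    case 3
    have "conv_den a b (Suc m) \<le> b n * conv_den a b (Suc m)"
      and "conv_den a b m \<le> a n * conv_den a b m"
      using assms[of n] 3 by auto
    moreover have "Suc m \<le> conv_den a b (Suc m)" "1 \<le> conv_den a b m"
      using less[of "Suc m"] less[of m] 3 by auto
    ultimately have "n \<le> b n * conv_den a b (Suc m) + a n * conv_den a b m"
      using 3 by linarith
    then show ?thesis using 3 by simp
  qed (use assms[of 1] in auto)
qed

lemma pcf_denom_ge:
  assumes "0 < x" "x < 1" "x \<notin> \<rat>" "\<forall>n\<ge>1. 0 < a n"
  shows "a n \<le> pcf_denom a x n"
proof -
  define y where "y = pcf_rem a x (n - 1)"
  have y: "0 < y" "y < 1" using pcf_rem_range[OF assms, of "n - 1"] by (auto simp: y_def)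
  then have "real (a n) \<le> real (a n) / y"
    by (simp add: le_divide_eq mult_left_le)
  then have "int (a n) \<le> \<lfloor>real (a n) / y\<rfloor>" by (simp add: le_floor_iff)
  then show ?thesis by (simp add: pcf_denom_def y_def)
qed

lemma pcf_rem_Suc_mult:
  assumes "0 < x" "x < 1" "x \<notin> \<rat>" "\<forall>n\<ge>1. 0 < a n"
  shows "pcf_rem a x n * (pcf_rem a x (Suc n) + real (pcf_denom a x (Suc n))) = real (a (Suc n))"
proof -
  have "0 < pcf_rem a x n" using pcf_rem_range[OF assms] by blast
  then show ?thesis by (simp add: pcf_denom_def T_def)
qed

text \<open>This is $x = (p_{n+1} + x_{n+1} p_n)/(q_{n+1} + x_{n+1} q_n)$ without fractions. In the
  induction step, $a_{n+2} = x_{n+1}(x_{n+2} + b_{n+2})$ and the induction hypothesis make the terms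
  with $b_{n+2}$ cancel.\<close>

lemma conv_error_Suc:
  assumes "0 < x" "x < 1" "x \<notin> \<rat>" "\<forall>n\<ge>1. 0 < a n"
  defines "b \<equiv> pcf_denom a x"
  defines "e \<equiv> \<lambda>n. real (conv_den a b n) * x - real (conv_num a b n)"
  shows "e (Suc n) = - pcf_rem a x (Suc n) * e n"
proof (induction n)
  case 0
  show ?case using pcf_rem_Suc_mult[OF assms(1-4), of 0]
    by (simp add: e_def b_def algebra_simps)
next
  case (Suc n)
  let ?r = "pcf_rem a x"
  have "e (Suc (Suc n)) = real (b (Suc (Suc n))) * e (Suc n) + real (a (Suc (Suc n))) * e n"
    by (simp add: e_def algebra_simps)
  also have "real (a (Suc (Suc n))) = ?r (Suc n) * (?r (Suc (Suc n)) + real (b (Suc (Suc n))))"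
    using pcf_rem_Suc_mult[OF assms(1-4), of "Suc n"] by (simp add: b_def)
  also have "real (b (Suc (Suc n))) * e (Suc n)
      + ?r (Suc n) * (?r (Suc (Suc n)) + real (b (Suc (Suc n)))) * e n
      = - ?r (Suc (Suc n)) * e (Suc n)"
    unfolding Suc by (simp add: algebra_simps del: pcf_rem.simps)
  finally show ?case .
qed

text \<open>All remainders lie in (0,1), so the errors $q_n x - p_n$ shrink in absolute value from
  the initial $x$ and stay below 1; dividing by $q_n \<ge> n$ yields convergence.\<close>

lemma pcf_expansion_pcf_denom:
  assumes "0 < x" "x < 1" "x \<notin> \<rat>" "\<forall>n\<ge>1. 0 < a n"
  shows "pcf_expansion x a (pcf_denom a x)"
proof -
  define b where "b = pcf_denom a x"
  define e where "e n = real (conv_den a b n) * x - real (conv_num a b n)" for n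
  have ab: "0 < a n \<and> 0 < b n \<and> a n \<le> b n" if "1 \<le> n" for n
    using assms(4) that pcf_denom_ge[OF assms, of n] by (auto simp: b_def intro: less_le_trans)
  then have q: "max 1 n \<le> conv_den a b n" for n
    by (intro conv_den_ge) blast
  have e: "\<bar>e n\<bar> \<le> 1" for n
  proof (induction n)
    case 0
    show ?case using assms(1,2) by (simp add: e_def)
  next
    case (Suc n)
    have "e (Suc n) = - pcf_rem a x (Suc n) * e n"
      using conv_error_Suc[OF assms] by (simp add: e_def b_def)
    then have "\<bar>e (Suc n)\<bar> = \<bar>pcf_rem a x (Suc n)\<bar> * \<bar>e n\<bar>"
      by (simp add: abs_mult)
    also have "\<dots> \<le> 1 * 1"
      using pcf_rem_range[OF assms, of "Suc n"] Suc by (intro mult_mono) auto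
    finally show ?case by simp
  qed
  have "(\<lambda>n. real (conv_num a b n) / real (conv_den a b n) - x) \<longlonglongrightarrow> 0"
  proof (rule tendsto_0_le[where K = 1])
    show "\<forall>\<^sub>F n in sequentially.
        norm (real (conv_num a b n) / real (conv_den a b n) - x) \<le> norm (1 / real n) * 1"
    proof (rule eventually_sequentiallyI[of 1])
      fix n :: nat assume n: "1 \<le> n"
      have qn: "0 < real (conv_den a b n)" "real n \<le> real (conv_den a b n)"
        using q[of n] by auto
      have "real (conv_num a b n) / real (conv_den a b n) - x = - e n / real (conv_den a b n)"
        using qn(1) by (simp add: e_def field_simps)
      then have "norm (real (conv_num a b n) / real (conv_den a b n) - x)
          = \<bar>e n\<bar> / real (conv_den a b n)" by simp
      also have "\<dots> \<le> 1 / real n"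
        using e[of n] qn n by (intro frac_le) auto
      finally show "norm (real (conv_num a b n) / real (conv_den a b n) - x)
          \<le> norm (1 / real n) * 1" by simp
    qed
    show "(\<lambda>n. 1 / real n) \<longlonglongrightarrow> 0" by (rule lim_1_over_n)
  qed
  then have "(\<lambda>n. real (conv_num a b n) / real (conv_den a b n)) \<longlonglongrightarrow> x"
    by (simp add: LIM_zero_iff)
  with ab show ?thesis unfolding pcf_expansion_def b_def by blast
qed

section \<open>The mediant bound\<close>

text \<open>As \<open>a 1\<close> and \<open>b 1\<close> are $p_1$ and $q_1$, the bound is the
  mediant of the first two convergents. The cross difference \<open>e\<close> satisfies the
  recurrence of the convergents, with \<open>e 1 = - e 2\<close>, so
  \<open>e 3 = (b 3 - a 3) * e 2\<close>; from two consecutive nonnegative values on, it stays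
  nonnegative.\<close>

lemma conv_le_mediant:
  assumes "a 3 \<le> b 3" "2 \<le> n"
  shows "conv_num a b n * (conv_den a b 2 + b 1) \<le> (conv_num a b 2 + a 1) * conv_den a b n"
proof -
  define e where "e n = (real (conv_num a b 2) + real (a 1)) * real (conv_den a b n)
    - real (conv_num a b n) * (real (conv_den a b 2) + real (b 1))" for n
  have rec: "e (Suc (Suc n)) = real (b (Suc (Suc n))) * e (Suc n) + real (a (Suc (Suc n))) * e n" for n
    by (simp add: e_def algebra_simps)
  have e1: "e 1 = - (real (a 1) * real (a 2))" and e2: "e 2 = real (a 1) * real (a 2)"
    by (simp_all add: e_def numeral_2_eq_2 algebra_simps)
  have "e 3 = (real (b 3) - real (a 3)) * e 2"
    using rec[of 1] e1 e2 by (simp add: numeral_2_eq_2 numeral_3_eq_3 algebra_simps)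
  then have e3: "0 \<le> e 3"
    using assms(1) e2 by simp
  have "0 \<le> e n \<and> 0 \<le> e (Suc n)"
    using \<open>2 \<le> n\<close>
  proof (induction n rule: dec_induct)
    case base
    show ?case using e2 e3 by (simp add: numeral_2_eq_2 numeral_3_eq_3)
  next
    case (step n)
    then show ?case using rec[of n] by simp
  qed
  then have "0 \<le> e n" ..
  then have "real (conv_num a b n * (conv_den a b 2 + b 1))
    \<le> real ((conv_num a b 2 + a 1) * conv_den a b n)"
    unfolding e_def of_nat_mult of_nat_add by linarith
  then show ?thesis by (simp only: of_nat_le_iff)
qed

lemma pcf_expansion_le_mediant:
  assumes "pcf_expansion x a b"
  shows "x \<le> real (conv_num a b 2 + a 1) / real (conv_den a b 2 + b 1)"
proof (rule LIMSEQ_le_const2)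
  have ab: "0 < a n \<and> 0 < b n \<and> a n \<le> b n" if "1 \<le> n" for n
    using assms that by (auto simp: pcf_expansion_def)
  show "(\<lambda>n. real (conv_num a b n) / real (conv_den a b n)) \<longlonglongrightarrow> x"
    using assms by (simp add: pcf_expansion_def)
  have "real (conv_num a b n) / real (conv_den a b n)
      \<le> real (conv_num a b 2 + a 1) / real (conv_den a b 2 + b 1)" if "2 \<le> n" for n
  proof -
    have "conv_num a b n * (conv_den a b 2 + b 1) \<le> (conv_num a b 2 + a 1) * conv_den a b n"
      using ab[of 3] that by (intro conv_le_mediant) auto
    then have "real (conv_num a b n) * real (conv_den a b 2 + b 1)
        \<le> real (conv_num a b 2 + a 1) * real (conv_den a b n)"
      by (simp only: of_nat_le_iff flip: of_nat_mult)
    moreover have "0 < real (conv_den a b n)"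
      using conv_den_ge[of a b n] ab by force
    moreover have "0 < real (conv_den a b 2 + b 1)"
      using ab[of 1] by simp
    moreover have "y / z \<le> v / w" if "y * w \<le> v * z" "0 < z" "0 < w" for y z v w :: real
      using that by (simp add: field_simps)
    ultimately show ?thesis by blast
  qed
  then show "\<exists>N. \<forall>n\<ge>N. real (conv_num a b n) / real (conv_den a b n)
      \<le> real (conv_num a b 2 + a 1) / real (conv_den a b 2 + b 1)"
    by blast
qed

section \<open>Even candidates and the equivalence\<close>

text \<open>For $p/q < x$ the absolute value is $x - p/q$; both inequalities are then multiplied by
  $q/x$.\<close>

lemma even_candidate_pair_iff:
  assumes "0 < x"
  shows "even_candidate_pair x p q
    \<longleftrightarrow> 0 < p \<and> 0 < q \<and> real p / x < real q \<and> real q < real p / x + 1"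
  using assms by (auto simp: even_candidate_pair_def candidate_pair_def field_simps abs_if)

theorem theorem3p11:
  fixes x :: real and p q :: nat
  assumes "0 < x" and "x < 1" and "x \<notin> \<rat>"
    and "even_candidate_pair x p q"
  shows "(\<exists>a b. pcf_expansion x a b \<and> p = conv_num a b 2 \<and> q = conv_den a b 2)
         \<longleftrightarrow> (\<exists>a::nat. 0 < a \<and> a dvd p \<and> T p x + T a x > 1)"
proof
  have pq: "0 < p" "0 < q" "real p / x < real q" "real q < real p / x + 1"
    using assms(4) even_candidate_pair_iff[OF assms(1)] by auto
  \<comment> \<open>The floor of \<open>p / x\<close> is \<open>q - 1\<close>, an exact subtraction
    because \<open>q\<close> is positive.\<close>
  have Tp: "T p x = real p / x - real q + 1"
    using T_eqI[of "q - 1" p x] pq by simp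
  {
    assume "\<exists>a b. pcf_expansion x a b \<and> p = conv_num a b 2 \<and> q = conv_den a b 2"
    then obtain a b where exp: "pcf_expansion x a b"
      and p: "p = conv_num a b 2" and q: "q = conv_den a b 2" by blast
    have ab: "0 < a n \<and> 0 < b n \<and> a n \<le> b n" if "1 \<le> n" for n
      using exp that by (auto simp: pcf_expansion_def)
    have p2: "p = b 2 * a 1" and q2: "q = b 2 * b 1 + a 2"
      by (simp_all add: p q numeral_2_eq_2)
    have pos: "0 < a 1" "0 < b 1" "0 < a 2" "0 < b 2" "a 2 \<le> b 2"
      using ab[of 1] ab[of 2] by auto
    define m where "m = real (p + a 1) / real (q + b 1)"
    have "x \<le> m"
      using pcf_expansion_le_mediant[OF exp] by (simp add: p q m_def)
    moreover have "x \<noteq> m"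
      using assms(3) by (auto simp: m_def)
    ultimately have "x < m" by simp
    then have lt: "real (q + b 1) < (real p + real (a 1)) / x"
      using pos assms(1) by (simp add: m_def field_simps)
    have mul: "real p / x = real (b 2) * (real (a 1) / x)"
      by (simp add: p2)
    \<comment> \<open>Otherwise \<open>lt\<close> would give $b_1 b_2 + a_2 + b_1 < b_1 b_2 + b_1$,
      against $a_2 > 0$.\<close>
    have "real (b 1) < real (a 1) / x"
    proof (rule ccontr)
      assume "\<not> real (b 1) < real (a 1) / x"
      then have "real (a 1) / x \<le> real (b 1)" by simp
      then have "real p / x \<le> real (b 2) * real (b 1)"
        unfolding mul by (intro mult_left_mono) auto
      with \<open>real (a 1) / x \<le> real (b 1)\<close> lt pos show False
        by (simp add: q2 add_divide_distrib)
    qed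
    \<comment> \<open>Here $a_2 \<le> b_2$ enters: $b_2 a_1 / x = p/x < q = b_1 b_2 + a_2 \<le> b_2
      (b_1 + 1)$.\<close>
    moreover have "real (a 1) / x < real (b 1) + 1"
    proof -
      have "real (b 2) * (real (a 1) / x) < real q"
        using pq(3) by (simp add: mul)
      also have "\<dots> \<le> real (b 2) * (real (b 1) + 1)"
        using pos by (simp add: q2 algebra_simps)
      finally show ?thesis using pos by (simp only: mult_less_cancel_left_pos of_nat_0_less_iff)
    qed
    ultimately have "T (a 1) x = real (a 1) / x - real (b 1)"
      by (intro T_eqI) auto
    \<comment> \<open>With the floors $q - 1$ and $b_1$, the claim reads $p/x + a_1/x > q + b_1$,
      which is \<open>lt\<close>.\<close>
    with Tp lt have "T p x + T (a 1) x > 1"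
      by (simp add: add_divide_distrib)
    with pos p2 show "\<exists>a::nat. 0 < a \<and> a dvd p \<and> T p x + T a x > 1"
      by (intro exI[of _ "a 1"]) auto
  }
  {
    assume "\<exists>a::nat. 0 < a \<and> a dvd p \<and> T p x + T a x > 1"
    then obtain c d where c: "0 < c" and p: "p = c * d" and gt: "T p x + T c x > 1"
      by (auto simp: dvd_def)
    define k where "k = nat \<lfloor>real c / x\<rfloor>"
    have "0 \<le> real c / x" using assms(1) by simp
    then have Tc: "T c x = real c / x - real k"
      by (simp add: T_def k_def)
    have "0 < T c x" "T c x < 1"
      using T_pos[OF assms(3) c] T_bounds(2) by auto
    have "real p / x = real d * (real c / x)" by (simp add: p)
    \<comment> \<open>Fractional parts show that the second numerator forced by $q = b_1 b_2 + a_2$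
      is positive.\<close>
    then have eq: "real q - real d * real k = real d * T c x + (1 - T p x)"
      by (simp add: Tp Tc algebra_simps)
    have "0 < real d * T c x + (1 - T p x)"
      using \<open>0 < T c x\<close> T_bounds(2)[of p x] by (intro add_nonneg_pos) auto
    then have "real (d * k) < real q" using eq by simp
    then have less: "d * k < q" by (simp only: of_nat_less_iff)
    define f where "f = q - d * k"
    have f: "0 < f" "real f = real d * T c x + (1 - T p x)"
      using less eq by (auto simp: f_def)
    \<comment> \<open>The first two numerators are dictated by $p$ and $q$; the later ones may be
      any positive integers.\<close>
    define a where "a n = (if n = 1 then c else if n = 2 then f else 1)" for n :: nat
    have a: "0 < a n" for n using c f by (simp add: a_def)
    \<comment> \<open>The quotient is $d + (1 - T_p(x))/T_c(x)$, and \<open>gt\<close> says exactly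
      that the added fraction is below 1.\<close>
    have "real d \<le> real f / T c x" "real f / T c x < real d + 1"
      using f(2) gt \<open>0 < T c x\<close> T_bounds(2)[of p x] by (auto simp: field_simps)
    then have "\<lfloor>real f / T c x\<rfloor> = int d"
      by (intro floor_unique) auto
    then have b: "pcf_denom a x 1 = k" "pcf_denom a x 2 = d"
      by (simp_all add: pcf_denom_def a_def k_def)
    have "conv_num a (pcf_denom a x) 2 = d * c" "conv_den a (pcf_denom a x) 2 = d * k + f"
      using b by (simp_all add: numeral_2_eq_2 a_def)
    then have "p = conv_num a (pcf_denom a x) 2" "q = conv_den a (pcf_denom a x) 2"
      using less by (simp_all add: p f_def)
    with pcf_expansion_pcf_denom[OF assms(1-3), of a] a
    show "\<exists>a b. pcf_expansion x a b \<and> p = conv_num a b 2 \<and> q = conv_den a b 2"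
      by blast
  }
qed

end
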